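(* Consider the two-type bandit problem with an arm-reservoir described in the context, with gap $\Delta>0$. (1) Under Model 1 (exogenous reservoir), if $\sum_{t=1}^{\infty}\alpha(t)<\infty$, then for any policy $\pi\in\Pi$ the expected cumulative regret grows linearly in the horizon of play, i.e., $\mathbb{E}R_n^{\pi}=\Omega(\Delta n)$, where $\Omega(\cdot)$ hides only multiplicative constants independent of $\Delta$ and $n$. Equivalently, $\sum_{t=1}^{\infty}\alpha(t)=\infty$ is a necessary condition for achieving sub-linear regret. (2) Under Model 2 (endogenous reservoir), if $\sum_{t=1}^{\infty}g(t)<\infty$, then for any policy $\pi\in\Pi$ the expected cumulative regret grows linearly in the horizon of play, i.e., $\mathbb{E}R_n^{\pi}=\Omega(\Delta n)$, where $\Omega(\cdot)$ hides only multiplicative constants independent of $\Delta$ and $n$. Equivalently, $\sum_{t=1}^{\infty}g(t)=\infty$ is a necessary condition for achieving sub-linear regret.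
   Context: Bandit problem. There are two arm-types, $\mathcal{K}=\{1,2\}$, with mean rewards $\mu_1>\mu_2$; the gap is $\Delta:=\mu_1-\mu_2>0$. Type 1 is called optimal, type 2 inferior. One arm is played at each time $t\in\{1,\dots,n\}$, where $n$ is the horizon of play. Let $\mathcal{I}_t$ be the set of arms played at least once up to and including time $t$ ($\mathcal{I}_0=\emptyset$). At time $t$ the action set is $\mathcal{A}_t=\mathcal{I}_{t-1}\cup\{\mathrm{new}_t\}$: either replay a previously played arm, or play a new arm queried from the reservoir. An arm queried at time $t$ is of type 1 with probability $\alpha(t)$ and of type 2 otherwise. Types are never observed. The $j$-th pull of arm $i$ yields a $[0,1]$-valued reward $X_{i,j}$ whose mean is $\mu_k$ if arm $i$ has type $k$; rewards are independent across arms and time (for a fixed arm they have a constant mean but need not be identically distributed). $N_i(t)$ denotes the number of pulls of arm $i$ up to time $t$. Policies. A policy $\pi=(\pi_1,\pi_2,\dots)$ prescribes at each time $t$ a (possibly randomized) action $\pi_t\in\mathcal{A}_t$. $\Pi$ is the class of non-anticipating policies: the distribution of $\pi_t$ on $\mathcal{A}_t$ is determined by the information available up to time $t-1$, namely $\mathcal{F}_{t-1}=\sigma\{(\pi_s)_{1\le s\le t-1},\{(X_{i,j})_{1\le j\le N_i(t-1)}:i\in\mathcal{I}_{t-1}\}\}$. Regret. $R_n^{\pi}:=\sum_{t=1}^{n}(\mu_1-X_{\pi_t,N_{\pi_t}(t)})$. One has $\mathbb{E}R_n^\pi=\mathbb{E}\sum_{t=1}^{n}(\mu_1-\mu_{\kappa(\pi_t)})$,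 where $\kappa(\pi_t)\in\{1,2\}$ is the type of the arm played at time $t$. Expectations are over rewards, policy randomization and reservoir randomness. Model 1 (exogenous reservoir): $(\alpha(t):t=1,2,\dots)$ is a non-increasing deterministic process with $\alpha(1)=c\in(0,1)$, evolving independently of the decision maker's actions. Model 2 (endogenous reservoir): $\alpha(t)=g(\mathcal{J}_{t-1})$, where $g:\mathbb{N}\cup\{0\}\to(0,c]$ is a non-increasing deterministic mapping with $g(0)=c\in(0,1)$, and $\mathcal{J}_t$ is the number of reservoir queries made up to and including time $t$, with $\mathcal{J}_0:=0$. The constants hidden in $\Omega(\cdot)$ may depend on the reservoir (i.e., on $\alpha(\cdot)$, respectively $g$). *)

theory Defs
  imports "HOL-Probability.Probability"
begin

datatype arm_type = Type1 | Type2

text \<open>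
  Arms are named by the round in which they are queried: the arm \<open>new\<^sub>t\<close> offered by the reservoir
  in round \<open>t \<ge> 1\<close> is \<open>t\<close>, so that a query in round \<open>t\<close> is the event \<open>\<pi>\<^sub>t = t\<close>.
  A history maps each elapsed round to the arm played and the reward observed in it.
\<close>

type_synonym history = "nat \<Rightarrow> nat \<times> real"

definition history_space :: "nat \<Rightarrow> history measure" where
  "history_space t = (\<Pi>\<^sub>M s\<in>{1..t}. count_space UNIV \<Otimes>\<^sub>M borel)"

abbreviation arm_at :: "history \<Rightarrow> nat \<Rightarrow> nat" where
  "arm_at h t \<equiv> fst (h t)"

definition num_pulls :: "history \<Rightarrow> nat \<Rightarrow> nat \<Rightarrow> nat" where
  "num_pulls h i t = card {s \<in> {1..t}. arm_at h s = i}"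

definition num_queries :: "history \<Rightarrow> nat \<Rightarrow> nat" where
  "num_queries h t = card {s \<in> {1..t}. arm_at h s = s}"

text \<open>
  A policy maps the round \<open>t\<close> and the history of the rounds before \<open>t\<close> to the distribution of the
  action \<open>\<pi>\<^sub>t\<close>.
\<close>

type_synonym policy = "nat \<Rightarrow> history \<Rightarrow> nat pmf"

definition action_set :: "history \<Rightarrow> nat \<Rightarrow> nat set" where
  "action_set h t = arm_at h ` {1..<t} \<union> {t}"

definition non_anticipating :: "policy \<Rightarrow> bool" where
  "non_anticipating pol \<longleftrightarrow>
     (\<forall>t. (\<lambda>h. measure_pmf (pol (Suc t) h))
             \<in> history_space t \<rightarrow>\<^sub>M prob_algebra (count_space UNIV)) \<and>
     (\<forall>t. \<forall>h\<in>space (history_space t). set_pmf (pol (Suc t) h) \<subseteq> action_set h (Suc t))"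

text \<open>
  \<open>\<nu> i j k\<close> is the law of the reward of the \<open>j\<close>-th pull of arm \<open>i\<close> if that arm has type \<open>k\<close>.
\<close>

type_synonym reward_laws = "nat \<Rightarrow> nat \<Rightarrow> arm_type \<Rightarrow> real measure"

definition valid_reward_laws :: "(arm_type \<Rightarrow> real) \<Rightarrow> reward_laws \<Rightarrow> bool" where
  "valid_reward_laws \<mu> \<nu> \<longleftrightarrow>
     (\<forall>i j k. prob_space (\<nu> i j k) \<and> sets (\<nu> i j k) = sets borel \<and>
        (AE x in \<nu> i j k. x \<in> {0..1}) \<and> (\<integral>x. x \<partial>\<nu> i j k) = \<mu> k)"

text \<open>
  All randomness comes from independent sources: one uniform variable per round for the type of a
  queried arm, one per round for the randomization of the policy, and the rewards. For each
  \<open>i\<close> and \<open>j\<close> a reward is drawn for either type; only the one matching the actual type of arm \<open>i\<close>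
  is used, see \<open>reward\<close> below.
\<close>

datatype source = Type_Draw nat | Policy_Draw nat | Reward_Draw nat nat arm_type

definition unit_uniform :: "real measure" where
  "unit_uniform = uniform_measure lborel {0..<1}"

primrec source_law :: "reward_laws \<Rightarrow> source \<Rightarrow> real measure" where
  "source_law \<nu> (Type_Draw t) = unit_uniform"
| "source_law \<nu> (Policy_Draw t) = unit_uniform"
| "source_law \<nu> (Reward_Draw i j k) = \<nu> i j k"

definition bandit_space :: "reward_laws \<Rightarrow> (source \<Rightarrow> real) measure" where
  "bandit_space \<nu> = (\<Pi>\<^sub>M s\<in>UNIV. source_law \<nu> s)"

text \<open>Inverse transform sampling; \<open>distr_sample\<close> below justifies the definition.\<close>

definition sample :: "nat pmf \<Rightarrow> real \<Rightarrow> nat" where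
  "sample p u = (LEAST a. u < measure_pmf.prob p {..a})"

lemma sample_eq_iff:
  assumes "u \<in> {0..<1}"
  shows "sample p u = a \<longleftrightarrow> u \<in> {measure_pmf.prob p {..<a}..<measure_pmf.prob p {..a}}"
proof -
  let ?F = "\<lambda>a::nat. measure_pmf.prob p {..a}"
  have mono: "?F a \<le> ?F b" if "a \<le> b" for a b
    using that by (intro measure_pmf.finite_measure_mono) auto
  have "?F \<longlonglongrightarrow> measure_pmf.prob p (\<Union>a. {..a})"
    by (intro measure_pmf.finite_Lim_measure_incseq) (auto simp: incseq_def)
  moreover have "(\<Union>a::nat. {..a}) = UNIV" by auto
  ultimately have "?F \<longlonglongrightarrow> 1" by simp
  then have "\<forall>\<^sub>F a in sequentially. u < ?F a"
    by (rule order_tendstoD) (use assms in auto)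
  then obtain b where b: "u < ?F b" by (auto simp: eventually_sequentially)
  have L: "u < ?F (sample p u)" unfolding sample_def by (rule LeastI[of "\<lambda>a. u < ?F a", OF b])
  have M: "sample p u \<le> a" if "u < ?F a" for a
    unfolding sample_def using that by (rule Least_le)
  have low: "measure_pmf.prob p {..<a} \<le> u \<longleftrightarrow> (\<forall>c<a. ?F c \<le> u)" for a
  proof (cases a)
    case 0 then show ?thesis using assms by simp
  next
    case (Suc k)
    then show ?thesis using mono by (auto simp: lessThan_Suc_atMost less_Suc_eq_le intro: order_trans)
  qed
  show ?thesis
    unfolding atLeastLessThan_iff low using L M by (metis leD le_neq_implies_less leI)
qed

lemma distr_sample: "distr unit_uniform (count_space UNIV) (sample p) = measure_pmf p"
proof (rule sym, rule measure_eqI_countable[of _ UNIV])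
  have sets: "sets unit_uniform = sets borel" by (simp add: unit_uniform_def)
  have meas: "sample p \<in> borel \<rightarrow>\<^sub>M count_space UNIV"
    unfolding sample_def by measurable
  fix a :: nat
  let ?l = "measure_pmf.prob p {..<a}" and ?r = "measure_pmf.prob p {..a}"
  have le: "0 \<le> ?l" "?r \<le> 1" "?l \<le> ?r" by (auto intro: measure_pmf.finite_measure_mono)
  have "{..a} = {..<a} \<union> {a}" by auto
  then have r: "?r = ?l + pmf p a"
    using measure_pmf.finite_measure_Union[of "{..<a}" p "{a}"] by (simp add: measure_pmf_single)
  have "emeasure (distr unit_uniform (count_space UNIV) (sample p)) {a}
      = emeasure unit_uniform (sample p -` {a})"
    using meas by (subst emeasure_distr) (auto simp: unit_uniform_def)
  also have "\<dots> = emeasure lborel ({0..<1} \<inter> sample p -` {a})"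
    unfolding unit_uniform_def
    by (subst emeasure_uniform_measure) (use measurable_sets[OF meas, of "{a}"] in \<open>auto simp: divide_ennreal_def\<close>)
  also have "{0..<1} \<inter> sample p -` {a} = {?l..<?r}"
  proof (intro set_eqI)
    fix u :: real
    have "u \<in> {0..<1}" if "u \<in> {?l..<?r}"
      using that order_trans[OF le(1), of u] order_less_le_trans[OF _ le(2), of u] by simp
    then show "u \<in> {0..<1} \<inter> sample p -` {a} \<longleftrightarrow> u \<in> {?l..<?r}"
      unfolding Int_iff vimage_singleton_eq using sample_eq_iff[of u p a] by metis
  qed
  also have "emeasure lborel {?l..<?r} = emeasure p {a}"
    using le r by (simp add: emeasure_pmf_single)
  finally show "emeasure p {a} = emeasure (distr unit_uniform (count_space UNIV) (sample p)) {a}" ..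
qed auto
text \<open>
  A reservoir \<open>\<rho>\<close> gives the probability \<open>\<rho> t j\<close> that an arm queried in round \<open>t\<close>, when \<open>j\<close> queries
  were made in earlier rounds, has type 1.
\<close>

type_synonym reservoir = "nat \<Rightarrow> nat \<Rightarrow> real"

definition exogenous :: "(nat \<Rightarrow> real) \<Rightarrow> reservoir" where
  "exogenous \<alpha> = (\<lambda>t j. \<alpha> t)"

definition endogenous :: "(nat \<Rightarrow> real) \<Rightarrow> reservoir" where
  "endogenous g = (\<lambda>t j. g j)"

definition model1 :: "(nat \<Rightarrow> real) \<Rightarrow> bool" where
  "model1 \<alpha> \<longleftrightarrow> 0 < \<alpha> 1 \<and> \<alpha> 1 < 1 \<and> (\<forall>t\<ge>1. 0 \<le> \<alpha> t) \<and> (\<forall>s t. 1 \<le> s \<longrightarrow> s \<le> t \<longrightarrow> \<alpha> t \<le> \<alpha> s)"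

definition model2 :: "(nat \<Rightarrow> real) \<Rightarrow> bool" where
  "model2 g \<longleftrightarrow> g 0 < 1 \<and> (\<forall>j. 0 < g j) \<and> antimono g"

definition type_of_arm :: "reservoir \<Rightarrow> (source \<Rightarrow> real) \<Rightarrow> history \<Rightarrow> nat \<Rightarrow> arm_type" where
  "type_of_arm \<rho> \<omega> h i =
     (if \<omega> (Type_Draw i) < \<rho> i (num_queries h (i - 1)) then Type1 else Type2)"

definition reward :: "reservoir \<Rightarrow> (source \<Rightarrow> real) \<Rightarrow> history \<Rightarrow> nat \<Rightarrow> nat \<Rightarrow> real" where
  "reward \<rho> \<omega> h i j = \<omega> (Reward_Draw i j (type_of_arm \<rho> \<omega> h i))"

text \<open>
  The history generated by a policy in the first \<open>t\<close> rounds. It is undefined outside \<open>{1..t}\<close> and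
  so lies in \<open>history_space t\<close>; the type of an arm \<open>i \<le> t + 1\<close> depends on rounds up to \<open>t\<close> only.
\<close>

primrec run :: "reservoir \<Rightarrow> policy \<Rightarrow> (source \<Rightarrow> real) \<Rightarrow> nat \<Rightarrow> history" where
  "run \<rho> pol \<omega> 0 = (\<lambda>_. undefined)"
| "run \<rho> pol \<omega> (Suc t) =
     (let h = run \<rho> pol \<omega> t;
          a = sample (pol (Suc t) h) (\<omega> (Policy_Draw (Suc t)))
      in h(Suc t := (a, reward \<rho> \<omega> h a (num_pulls h a t + 1))))"

definition regret ::
  "reservoir \<Rightarrow> (arm_type \<Rightarrow> real) \<Rightarrow> policy \<Rightarrow> (source \<Rightarrow> real) \<Rightarrow> nat \<Rightarrow> real" where
  "regret \<rho> \<mu> pol \<omega> n =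
     (let h = run \<rho> pol \<omega> n
      in \<Sum>t=1..n. \<mu> Type1 - reward \<rho> \<omega> h (arm_at h t) (num_pulls h (arm_at h t) t))"

definition expected_regret ::
  "reservoir \<Rightarrow> (arm_type \<Rightarrow> real) \<Rightarrow> reward_laws \<Rightarrow> policy \<Rightarrow> nat \<Rightarrow> real" where
  "expected_regret \<rho> \<mu> \<nu> pol n = (\<integral>\<omega>. regret \<rho> \<mu> pol \<omega> n \<partial>bandit_space \<nu>)"

text \<open>
  The multiplicative constant depends on the reservoir only; it is uniform in the means (hence in
  the gap), the reward laws, the policy and the horizon.
\<close>

definition linear_regret :: "reservoir \<Rightarrow> bool" where
  "linear_regret \<rho> \<longleftrightarrow>
     (\<exists>C>0. \<forall>\<mu> \<nu> pol n. \<mu> Type2 < \<mu> Type1 \<longrightarrow> valid_reward_laws \<mu> \<nu> \<longrightarrow> non_anticipating pol \<longrightarrow>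
        expected_regret \<rho> \<mu> \<nu> pol n \<ge> C * (\<mu> Type1 - \<mu> Type2) * real n)"

definition sublinear_regret_achievable :: "reservoir \<Rightarrow> bool" where
  "sublinear_regret_achievable \<rho> \<longleftrightarrow>
     (\<exists>\<mu> \<nu> pol. \<mu> Type2 < \<mu> Type1 \<and> valid_reward_laws \<mu> \<nu> \<and> non_anticipating pol \<and>
        expected_regret \<rho> \<mu> \<nu> pol \<in> o(real))"

end

theory Submission
  imports Defs
begin

text \<open>
  With a probability bounded away from zero no policy ever meets a type-1 arm. Let \<open>W t j\<close> be the
  product of \<open>1 - \<rho>\<close> over all later rounds (exogenous reservoir) or over all query counts from \<open>j\<close>
  on (endogenous reservoir). Since a query succeeds with probability \<open>\<rho>\<close> independently of the past,
  \<open>W t\<close> at the current number of queries, set to zero once a type-1 arm has been queried, is a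
  submartingale. It starts at \<open>W 0 0\<close>, which is positive by summability, and it is at most the
  indicator of the event that all arms queried so far are inferior; on that event every round costs
  the full gap.

  Independence is used through resampling: replacing one coordinate of the product space by a fresh
  draw preserves the law, and the history does not depend on coordinates it has not used.
\<close>

section \<open>Resampling one coordinate, and sampling from a distribution\<close>

instance arm_type :: countable by countable_datatype
text \<open>Countability lets \<open>measurable_compose_countable\<close> treat a coordinate with
  random index, such as the reward source read in a round.\<close>

instance source :: countable by countable_datatype

text \<open>The map sending \<open>(x, w)\<close> to \<open>w(s := x)\<close> carries the product of
  \<open>M s\<close> and \<open>PiM UNIV M\<close> to \<open>PiM UNIV M\<close>; Fubini then
  integrates out \<open>x\<close> first. This takes the place of conditional expectations.\<close>

lemma integral_PiM_resample:
  fixes f :: "('i \<Rightarrow> 'a) \<Rightarrow> real"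
  assumes M: "\<And>i. prob_space (M i)" and f: "integrable (PiM UNIV M) f"
  shows "(\<integral>w. f w \<partial>PiM UNIV M) = (\<integral>w. (\<integral>x. f (w(s := x)) \<partial>M s) \<partial>PiM UNIV M)"
    and "integrable (PiM UNIV M) (\<lambda>w. \<integral>x. f (w(s := x)) \<partial>M s)"
proof -
  let ?P = "PiM UNIV M" and ?u = "\<lambda>(x, w). w(s := x)"
  interpret P: prob_space ?P by (intro prob_space_PiM M)
  interpret Ms: prob_space "M s" by (rule M)
  interpret pair_sigma_finite "M s" ?P ..
  have u: "?u \<in> M s \<Otimes>\<^sub>M ?P \<rightarrow>\<^sub>M ?P"
    unfolding split_beta' by (rule measurable_fun_upd[where J=UNIV]) auto
  have d: "distr (M s \<Otimes>\<^sub>M ?P) ?P ?u = ?P"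
    using distr_pair_PiM_eq_PiM[of UNIV M s] M by simp
  have f_meas: "f \<in> borel_measurable ?P" using f by auto
  have int: "integrable (M s \<Otimes>\<^sub>M ?P) (\<lambda>(x, w). f (w(s := x)))"
    using integrable_distr_eq[OF u f_meas] f unfolding d by (simp add: split_beta')
  have "(\<integral>w. f w \<partial>?P) = (\<integral>(x, w). f (w(s := x)) \<partial>(M s \<Otimes>\<^sub>M ?P))"
    using integral_distr[OF u f_meas] unfolding d by (simp add: split_beta')
  also have "\<dots> = (\<integral>w. (\<integral>x. f (w(s := x)) \<partial>M s) \<partial>?P)"
    using integral_snd[OF int] by simp
  finally show "(\<integral>w. f w \<partial>?P) = (\<integral>w. (\<integral>x. f (w(s := x)) \<partial>M s) \<partial>?P)" .
  show "integrable ?P (\<lambda>w. \<integral>x. f (w(s := x)) \<partial>M s)"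
    using integrable_snd[OF int] by simp
qed

lemma prob_space_unit_uniform: "prob_space unit_uniform"
  unfolding unit_uniform_def by (rule prob_space_uniform_measure) auto

lemma sets_unit_uniform [simp, measurable_cong]: "sets unit_uniform = sets borel"
  by (simp add: unit_uniform_def)

lemma measure_unit_uniform_atLeast:
  assumes "0 \<le> r" "r \<le> 1"
  shows "measure unit_uniform {r..} = 1 - r"
proof -
  have "{0..<1} \<inter> {r..} = {r..<1}" using assms by auto
  then have "emeasure unit_uniform {r..} = ennreal (1 - r)"
    unfolding unit_uniform_def using assms by (subst emeasure_uniform_measure) (auto simp: divide_ennreal_def)
  then show ?thesis using assms by (simp add: measure_def)
qed

text \<open>The values of \<open>u\<close> sent to an arm form a half-open interval whose length is
  the probability of that arm. Containing \<open>u\<close>, it is nonempty and so has positive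
  length.\<close>

lemma sample_in_set_pmf:
  assumes "u \<in> {0..<1}"
  shows "sample p u \<in> set_pmf p"
proof -
  let ?a = "sample p u"
  have "{..?a} = {..<?a} \<union> {?a}" by auto
  then have "measure_pmf.prob p {..?a} = measure_pmf.prob p {..<?a} + pmf p ?a"
    using measure_pmf.finite_measure_Union[of "{..<?a}" p "{?a}"] by (simp add: measure_pmf_single)
  moreover have "measure_pmf.prob p {..<?a} < measure_pmf.prob p {..?a}"
    using sample_eq_iff[OF assms, of p ?a] by auto
  ultimately show ?thesis by (simp add: set_pmf_iff)
qed

lemma measurable_sample:
  assumes p: "(\<lambda>x. measure_pmf (p x)) \<in> M \<rightarrow>\<^sub>M prob_algebra (count_space UNIV)"
    and u [measurable]: "u \<in> borel_measurable M"
  shows "(\<lambda>x. sample (p x) (u x)) \<in> M \<rightarrow>\<^sub>M count_space UNIV"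
proof -
  have [measurable]: "(\<lambda>x. measure_pmf.prob (p x) {..a}) \<in> borel_measurable M" for a
    by (rule measure_measurable_prob_algebra2[OF _ p]) auto
  show ?thesis unfolding sample_def by measurable
qed

section \<open>The history of a fixed policy under fixed reward laws\<close>

locale bandit =
  fixes \<rho> :: reservoir and \<mu> :: "arm_type \<Rightarrow> real" and \<nu> :: reward_laws and pol :: policy
  assumes laws: "valid_reward_laws \<mu> \<nu>" and policy: "non_anticipating pol"
begin

abbreviation "P \<equiv> bandit_space \<nu>"

abbreviation "H \<equiv> run \<rho> pol"

text \<open>Index \<open>t\<close> stands for round \<open>Suc t\<close>, whose arm is chosen from
  the history \<open>H w t\<close> of the \<open>t\<close> earlier rounds. \<open>kind\<close> and
  \<open>draw\<close> follow the same shift.\<close>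

definition action :: "(source \<Rightarrow> real) \<Rightarrow> nat \<Rightarrow> nat" where
  "action w t = sample (pol (Suc t) (H w t)) (w (Policy_Draw (Suc t)))"

definition kind :: "(source \<Rightarrow> real) \<Rightarrow> nat \<Rightarrow> arm_type" where
  "kind w t = type_of_arm \<rho> w (H w t) (action w t)"

text \<open>The coordinate of \<open>w\<close> revealed as reward, so that the reward is
  \<open>w (draw w t)\<close>. Keeping the coordinate apart from its value is what allows it to be
  resampled.\<close>

definition draw :: "(source \<Rightarrow> real) \<Rightarrow> nat \<Rightarrow> source" where
  "draw w t = Reward_Draw (action w t) (num_pulls (H w t) (action w t) t + 1) (kind w t)"

abbreviation "queries w t \<equiv> num_queries (H w t) t"

lemma run_Suc: "H w (Suc t) = (H w t)(Suc t := (action w t, w (draw w t)))"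
  by (simp add: Let_def action_def draw_def kind_def reward_def)

declare run.simps(2) [simp del]

lemma run_outside: "s \<notin> {1..t} \<Longrightarrow> H w t s = undefined"
  by (induction t) (auto simp: run_Suc)

lemma run_inside: "s < t \<Longrightarrow> H w t (Suc s) = (action w s, w (draw w s))"
  by (induction t) (auto simp: run_Suc less_Suc_eq)

lemma run_inside': "s \<in> {1..t} \<Longrightarrow> H w t s = (action w (s - 1), w (draw w (s - 1)))"
  using run_inside[of "s - 1" t w] by auto

lemma num_pulls_run: "s \<le> t \<Longrightarrow> num_pulls (H w t) i s = num_pulls (H w s) i s"
  unfolding num_pulls_def by (intro arg_cong[where f=card]) (auto simp: run_inside')

lemma num_queries_run: "s \<le> t \<Longrightarrow> num_queries (H w t) s = queries w s"
  unfolding num_queries_def by (intro arg_cong[where f=card]) (auto simp: run_inside')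

lemma num_pulls_Suc:
  "num_pulls (H w (Suc t)) i (Suc t) = num_pulls (H w t) i t + of_bool (action w t = i)"
proof -
  have "{s \<in> {1..Suc t}. arm_at (H w (Suc t)) s = i} =
      {s \<in> {1..t}. arm_at (H w t) s = i} \<union> (if action w t = i then {Suc t} else {})"
    by (auto simp: run_Suc le_Suc_eq)
  then show ?thesis unfolding num_pulls_def by simp
qed

lemma queries_Suc: "queries w (Suc t) = queries w t + of_bool (action w t = Suc t)"
proof -
  have "{s \<in> {1..Suc t}. arm_at (H w (Suc t)) s = s} =
      {s \<in> {1..t}. arm_at (H w t) s = s} \<union> (if action w t = Suc t then {Suc t} else {})"
    by (auto simp: run_Suc le_Suc_eq)
  then show ?thesis unfolding num_queries_def by simp
qed

subsection \<open>The probability space\<close>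

lemma prob_space_source: "prob_space (source_law \<nu> s)"
  using laws by (cases s) (auto simp: valid_reward_laws_def prob_space_unit_uniform)

lemma sets_source [simp, measurable_cong]: "sets (source_law \<nu> s) = sets borel"
  using laws by (cases s) (auto simp: valid_reward_laws_def)

sublocale prob_space P
  unfolding bandit_space_def by (intro prob_space_PiM prob_space_source)

lemma measurable_source [measurable]: "(\<lambda>w. w s) \<in> borel_measurable P"
proof -
  have "(\<lambda>w. w s) \<in> P \<rightarrow>\<^sub>M source_law \<nu> s"
    unfolding bandit_space_def by (rule measurable_component_singleton) simp
  then show ?thesis by (simp cong: measurable_cong_sets)
qed

text \<open>From here to \<open>measurable_draw'\<close>, measurability of the history is a
  hypothesis, because these facts supply the induction step of
  \<open>measurable_run\<close>.\<close>

lemma measurable_run_apply: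
  assumes "(\<lambda>w. H w t) \<in> P \<rightarrow>\<^sub>M history_space t"
  shows "(\<lambda>w. arm_at (H w t) s) \<in> P \<rightarrow>\<^sub>M count_space UNIV"
proof (cases "s \<in> {1..t}")
  case True
  show ?thesis
    by (rule measurable_compose[OF assms]) (use True in \<open>unfold history_space_def, measurable\<close>)
qed (simp add: run_outside)

lemma measurable_counts:
  assumes "(\<lambda>w. H w t) \<in> P \<rightarrow>\<^sub>M history_space t"
  shows "(\<lambda>w. num_pulls (H w t) i s) \<in> P \<rightarrow>\<^sub>M count_space UNIV"
    and "(\<lambda>w. num_queries (H w t) s) \<in> P \<rightarrow>\<^sub>M count_space UNIV"
proof -
  note [measurable] = measurable_run_apply[OF assms]
  show "(\<lambda>w. num_pulls (H w t) i s) \<in> P \<rightarrow>\<^sub>M count_space UNIV"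
    unfolding num_pulls_def by measurable
  show "(\<lambda>w. num_queries (H w t) s) \<in> P \<rightarrow>\<^sub>M count_space UNIV"
    unfolding num_queries_def by measurable
qed

lemma measurable_action':
  assumes "(\<lambda>w. H w t) \<in> P \<rightarrow>\<^sub>M history_space t"
  shows "(\<lambda>w. action w t) \<in> P \<rightarrow>\<^sub>M count_space UNIV"
  unfolding action_def
  by (rule measurable_sample) (use policy measurable_compose[OF assms] in \<open>auto simp: non_anticipating_def\<close>)

lemma measurable_type_of_arm:
  assumes "(\<lambda>w. H w t) \<in> P \<rightarrow>\<^sub>M history_space t"
  shows "(\<lambda>w. type_of_arm \<rho> w (H w t) i) \<in> P \<rightarrow>\<^sub>M count_space UNIV"
proof -
  have [measurable]: "(\<lambda>w. \<rho> i (num_queries (H w t) (i - 1))) \<in> borel_measurable P"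
    by (rule measurable_compose[OF measurable_counts(2)[OF assms]]) simp
  show "(\<lambda>w. type_of_arm \<rho> w (H w t) i) \<in> P \<rightarrow>\<^sub>M count_space UNIV"
    unfolding type_of_arm_def by measurable
qed

lemma measurable_kind':
  assumes "(\<lambda>w. H w t) \<in> P \<rightarrow>\<^sub>M history_space t"
  shows "(\<lambda>w. kind w t) \<in> P \<rightarrow>\<^sub>M count_space UNIV"
  unfolding kind_def
  by (rule measurable_compose_countable[OF measurable_type_of_arm measurable_action']) (fact assms)+

lemma measurable_draw':
  assumes "(\<lambda>w. H w t) \<in> P \<rightarrow>\<^sub>M history_space t"
  shows "(\<lambda>w. draw w t) \<in> P \<rightarrow>\<^sub>M count_space UNIV"
proof -
  have "(\<lambda>w. num_pulls (H w t) (action w t) t) \<in> P \<rightarrow>\<^sub>M count_space UNIV"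
    by (rule measurable_compose_countable[OF measurable_counts(1) measurable_action']) (fact assms)+
  then have "(\<lambda>w. Reward_Draw i (num_pulls (H w t) (action w t) t + 1) k) \<in> P \<rightarrow>\<^sub>M count_space UNIV" for i k
    by (rule measurable_compose) simp
  then show ?thesis
    unfolding draw_def
    by (rule measurable_compose_countable[OF measurable_compose_countable[OF _ measurable_kind'] measurable_action'])
      (fact assms)+
qed

lemma measurable_run [measurable]: "(\<lambda>w. H w t) \<in> P \<rightarrow>\<^sub>M history_space t"
proof (induction t)
  case 0
  show ?case by (simp add: history_space_def space_PiM PiE_def extensional_def)
next
  case (Suc t)
  have [measurable]: "(\<lambda>w. w (draw w t)) \<in> borel_measurable P"
    by (rule measurable_compose_countable[OF _ measurable_draw'[OF Suc]]) measurable
  note [measurable] = measurable_action'[OF Suc]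
  have "{1..Suc t} = insert (Suc t) {1..t}" by auto
  then show ?case
    unfolding run_Suc history_space_def
    by (intro measurable_fun_upd[where J="{1..t}"]) (use Suc in \<open>auto simp: history_space_def\<close>)
qed

lemmas measurable_action [measurable] = measurable_action'[OF measurable_run]
lemmas measurable_kind [measurable] = measurable_kind'[OF measurable_run]
lemmas measurable_draw [measurable] = measurable_draw'[OF measurable_run]

lemma measurable_queries [measurable]: "(\<lambda>w. queries w t) \<in> P \<rightarrow>\<^sub>M count_space UNIV"
  by (rule measurable_counts(2)[OF measurable_run])

lemma measurable_reward_draw [measurable]: "(\<lambda>w. w (draw w t)) \<in> borel_measurable P"
  by (rule measurable_compose_countable[OF _ measurable_draw]) measurable

lemma measurable_regret [measurable]: "(\<lambda>w. regret \<rho> \<mu> pol w n) \<in> borel_measurable P"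
proof -
  have [measurable]: "(\<lambda>w. reward \<rho> w (H w n) i j) \<in> borel_measurable P" for i j
    unfolding reward_def
    by (rule measurable_compose_countable[OF _ measurable_type_of_arm[OF measurable_run]]) measurable
  have "(\<lambda>w. reward \<rho> w (H w n) i (num_pulls (H w n) i s)) \<in> borel_measurable P" for i s
    by (rule measurable_compose_countable[OF _ measurable_counts(1)[OF measurable_run]]) measurable
  then have [measurable]: "(\<lambda>w. reward \<rho> w (H w n) (arm_at (H w n) s) (num_pulls (H w n) (arm_at (H w n) s) s))
      \<in> borel_measurable P" for s
    by (rule measurable_compose_countable[OF _ measurable_run_apply[OF measurable_run]])
  show ?thesis unfolding regret_def Let_def by measurable
qed

lemma integral_resample:
  fixes f :: "(source \<Rightarrow> real) \<Rightarrow> real"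
  assumes "integrable P f"
  shows "(\<integral>w. f w \<partial>P) = (\<integral>w. (\<integral>x. f (w(s := x)) \<partial>source_law \<nu> s) \<partial>P)"
    and "integrable P (\<lambda>w. \<integral>x. f (w(s := x)) \<partial>source_law \<nu> s)"
  unfolding bandit_space_def
  by (rule integral_PiM_resample[OF prob_space_source assms[unfolded bandit_space_def]])+

lemma AE_source: "AE x in source_law \<nu> s. Q x \<Longrightarrow> AE w in P. Q (w s)"
  unfolding bandit_space_def by (rule AE_PiM_component[OF prob_space_source]) auto

subsection \<open>Regular outcomes\<close>

text \<open>Off \<open>{0..<1}\<close> the value of \<open>sample\<close> is junk and need not lie in the action set.\<close>

definition regular :: "(source \<Rightarrow> real) \<Rightarrow> bool" where
  "regular w \<longleftrightarrow> (\<forall>t. w (Policy_Draw t) \<in> {0..<1})"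

lemma AE_regular: "AE w in P. regular w"
  unfolding regular_def AE_all_countable
proof
  fix t
  have "AE x in unit_uniform. x \<in> {0..<1}"
    unfolding unit_uniform_def by (rule AE_uniform_measureI) auto
  then show "AE w in P. w (Policy_Draw t) \<in> {0..<1}"
    using AE_source[of _ "Policy_Draw t", unfolded source_law.simps] by blast
qed

text \<open>The second conjunct says that the arm was queried in the round bearing its name. A
  replay copies the arm of an earlier round, so strong induction leads back to that query.\<close>

lemma regular_action:
  assumes "regular w"
  shows "action w t \<in> {1..Suc t} \<and> action w (action w t - 1) = action w t"
proof (induction t rule: less_induct)
  case (less t)
  have "H w t \<in> space (history_space t)"
    by (auto simp: history_space_def space_PiM PiE_def extensional_def run_outside space_pair_measure)
  moreover have "action w t \<in> set_pmf (pol (Suc t) (H w t))"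
    unfolding action_def using assms by (intro sample_in_set_pmf) (auto simp: regular_def)
  ultimately have "action w t \<in> action_set (H w t) (Suc t)"
    using policy by (auto simp: non_anticipating_def)
  then have "action w t = Suc t \<or> (\<exists>s\<in>{1..t}. action w t = arm_at (H w t) s)"
    by (auto simp: action_set_def)
  then consider "action w t = Suc t" | s where "s \<in> {1..t}" "action w t = arm_at (H w t) s"
    by blast
  then show ?case
  proof cases
    case 2
    then have "action w t = action w (s - 1)" "s - 1 < t" by (auto simp: run_inside')
    then show ?thesis using less[of "s - 1"] 2 by auto
  qed simp
qed

lemma regret_eq:
  assumes "regular w"
  shows "regret \<rho> \<mu> pol w n = (\<Sum>t<n. \<mu> Type1 - w (draw w t))"
proof -
  have "reward \<rho> w (H w n) (arm_at (H w n) (Suc t)) (num_pulls (H w n) (arm_at (H w n) (Suc t)) (Suc t))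
      = w (draw w t)" if "t < n" for t
  proof -
    \<comment> \<open>The type of arm \<open>Suc a\<close> reads only the queries in rounds up to
      \<open>a\<close>, and the pull count only rounds up to \<open>Suc t\<close>. Hence the final
      history \<open>H w n\<close> gives the values that were current when the arm was
      played.\<close>
    obtain a where "action w t = Suc a" "a \<le> t"
      using regular_action[OF assms, of t] by (cases "action w t") auto
    then show ?thesis
      using that by (simp add: run_inside num_pulls_run[of "Suc t" n] num_pulls_Suc reward_def draw_def
          kind_def type_of_arm_def num_queries_run[of a n] num_queries_run[of a t])
  qed
  then show ?thesis
    by (auto simp: regret_def Let_def sum.atLeast1_atMost_eq intro!: sum.cong)
qed

subsection \<open>Invariance of the past under resampling\<close>

text \<open>Rewards of arm \<open>i\<close> read so far have pull indices at most the number of its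
  pulls, hence below \<open>j\<close>.\<close>

lemma run_update_reward:
  assumes "num_pulls (H w t) i t < j"
  shows "H (w(Reward_Draw i j k := x)) t = H w t"
  using assms
proof (induction t)
  case (Suc t)
  let ?w = "w(Reward_Draw i j k := x)"
  have H: "H ?w t = H w t" by (rule Suc.IH) (use Suc.prems in \<open>simp add: num_pulls_Suc\<close>)
  then have a: "action ?w t = action w t" by (simp add: action_def)
  with H have "draw ?w t = draw w t" by (simp add: draw_def kind_def type_of_arm_def)
  moreover have "?w (draw w t) = w (draw w t)" using Suc.prems by (auto simp: num_pulls_Suc draw_def)
  ultimately show ?case using H a by (simp only: run_Suc)
qed simp

text \<open>The pull index in \<open>draw w t\<close> exceeds all earlier ones of that arm, so the
  past ignores this source; arm and type are determined by the past, a policy draw and a type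
  draw.\<close>

lemma draw_update_draw:
  assumes "draw w t = s"
  shows "draw (w(s := x)) t = s"
proof -
  have "H (w(s := x)) t = H w t"
    unfolding assms[symmetric] draw_def by (rule run_update_reward) simp
  then show ?thesis using assms by (auto simp: draw_def kind_def type_of_arm_def action_def)
qed

lemma draw_update_iff: "draw (w(s := x)) t = s \<longleftrightarrow> draw w t = s"
  \<comment> \<open>For the converse, the old value \<open>w s\<close> is put back.\<close>
  using draw_update_draw[of w t s x] draw_update_draw[of "w(s := x)" t s "w s"] by auto

text \<open>The type draw of arm \<open>s\<close> is read only when that arm is played, and on
  regular outcomes this cannot happen before round \<open>s\<close>.\<close>

lemma run_update_type:
  assumes "regular w" "t < s"
  shows "H (w(Type_Draw s := x)) t = H w t"
  using assms(2)
proof (induction t)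
  case (Suc t)
  let ?w = "w(Type_Draw s := x)"
  have H: "H ?w t = H w t" by (rule Suc.IH) (use Suc.prems in simp)
  then have a: "action ?w t = action w t" by (simp add: action_def)
  have "action w t \<noteq> s" using regular_action[OF assms(1), of t] Suc.prems by auto
  with H a have "draw ?w t = draw w t" by (simp add: draw_def kind_def type_of_arm_def)
  moreover have "?w (draw w t) = w (draw w t)" by (simp add: draw_def)
  ultimately show ?case using H a by (simp only: run_Suc)
qed simp

lemma action_update_type:
  assumes "regular w" "t < s"
  shows "action (w(Type_Draw s := x)) t = action w t"
  using run_update_type[OF assms] by (simp add: action_def)

subsection \<open>Expected rewards\<close>

lemma integrable_reward:
  "integrable P (\<lambda>w. w (Reward_Draw i j k))"
proof (rule integrable_const_bound[of _ 1])
  have "AE x in \<nu> i j k. x \<in> {0..1}" using laws unfolding valid_reward_laws_def by blast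
  then have "AE x in \<nu> i j k. norm x \<le> 1" by (rule eventually_mono) auto
  then show "AE w in P. norm (w (Reward_Draw i j k)) \<le> 1"
    by (rule AE_source[of _ "Reward_Draw i j k", unfolded source_law.simps])
qed measurable

text \<open>Whether \<open>s\<close> is read in a given round does not depend on its value.
  Resampling \<open>s\<close> leaves the indicator fixed and averages the reward to its
  mean.\<close>

lemma expectation_of_bool_draw:
  fixes i j k
  defines "s \<equiv> Reward_Draw i j k"
  shows "(\<integral>w. of_bool (draw w t = s) * w s \<partial>P) = (\<integral>w. of_bool (draw w t = s) * \<mu> k \<partial>P)"
    and "integrable P (\<lambda>w. of_bool (draw w t = s) * w s)"
proof -
  show int: "integrable P (\<lambda>w. of_bool (draw w t = s) * w s)"
    by (rule Bochner_Integration.integrable_bound[OF integrable_reward[of i j k]]) (auto simp: s_def)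
  have "(\<integral>x. x \<partial>source_law \<nu> s) = \<mu> k" using laws by (simp add: s_def valid_reward_laws_def)
  then show "(\<integral>w. of_bool (draw w t = s) * w s \<partial>P) = (\<integral>w. of_bool (draw w t = s) * \<mu> k \<partial>P)"
    by (subst integral_resample(1)[OF int, of s]) (simp add: draw_update_iff)
qed

lemma finite_reward_draws: "finite {Reward_Draw i j k | i j k. i \<le> m \<and> j \<le> (m::nat)}"
proof -
  have "k \<in> {Type1, Type2}" for k by (cases k) auto
  then have "finite (UNIV :: arm_type set)"
    by (intro finite_subset[of UNIV "{Type1, Type2}"]) blast+
  then have "finite ((\<lambda>(i, j, k). Reward_Draw i j k) ` ({..m} \<times> {..m} \<times> UNIV))" by auto
  then show ?thesis by (rule rev_finite_subset) force
qed

text \<open>On regular outcomes only finitely many sources can be read in round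
  \<open>Suc t\<close>, so the reward splits into a finite sum over the source read, and
  \<open>expectation_of_bool_draw\<close> applies to each term.\<close>

lemma expectation_reward:
  shows "(\<integral>w. w (draw w t) \<partial>P) = (\<integral>w. \<mu> (kind w t) \<partial>P)"
    and "integrable P (\<lambda>w. w (draw w t))"
    and "integrable P (\<lambda>w. \<mu> (kind w t))"
proof -
  define F where "F = {Reward_Draw i j k | i j k. i \<le> Suc t \<and> j \<le> Suc t}"
  \<comment> \<open>The mean of a reward source; the value 0 for other sources is a filler, since
    \<open>draw\<close> never returns them.\<close>
  define m where "m s = (case s of Reward_Draw i j k \<Rightarrow> \<mu> k | _ \<Rightarrow> 0)" for s
  have F: "finite F" unfolding F_def by (rule finite_reward_draws)
  have draw_F: "draw w t \<in> F" if "regular w" for w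
  proof -
    have "num_pulls (H w t) i t \<le> card {1..t}" for i
      unfolding num_pulls_def by (intro card_mono) auto
    then show ?thesis using regular_action[OF that, of t] by (auto simp: F_def draw_def)
  qed
  have split: "f (draw w t) = (\<Sum>s\<in>F. of_bool (draw w t = s) * f s)" if "regular w" for w and f :: "source \<Rightarrow> real"
    using draw_F[OF that] F by (simp add: of_bool_def if_distrib[of "\<lambda>x. x * _"] sum.delta cong: if_cong)
  have m: "m (draw w t) = \<mu> (kind w t)" for w by (simp add: m_def draw_def)
  have term_eq: "(\<integral>w. of_bool (draw w t = s) * w s \<partial>P) = (\<integral>w. of_bool (draw w t = s) * m s \<partial>P)"
    "integrable P (\<lambda>w. of_bool (draw w t = s) * w s)" if "s \<in> F" for s
    using that expectation_of_bool_draw by (auto simp: F_def m_def)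
  have int_m: "integrable P (\<lambda>w. of_bool (draw w t = s) * m s)" for s
    by (rule integrable_const_bound[of _ "\<bar>m s\<bar>"]) auto
  have AE1: "AE w in P. w (draw w t) = (\<Sum>s\<in>F. of_bool (draw w t = s) * w s)"
    using AE_regular by eventually_elim (rule split)
  have AE2: "AE w in P. \<mu> (kind w t) = (\<Sum>s\<in>F. of_bool (draw w t = s) * m s)"
    using AE_regular by eventually_elim (metis split m)
  have [measurable]: "(\<lambda>w. \<mu> (kind w t)) \<in> borel_measurable P"
    by (rule measurable_compose[OF measurable_kind]) simp
  show "(\<integral>w. w (draw w t) \<partial>P) = (\<integral>w. \<mu> (kind w t) \<partial>P)"
    using integral_cong_AE[OF _ _ AE1] integral_cong_AE[OF _ _ AE2] term_eq int_m
    by (simp add: Bochner_Integration.integral_sum)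
  show "integrable P (\<lambda>w. w (draw w t))"
    by (subst integrable_cong_AE[OF _ _ AE1]) (use term_eq in auto)
  show "integrable P (\<lambda>w. \<mu> (kind w t))"
    by (subst integrable_cong_AE[OF _ _ AE2]) (use int_m in auto)
qed

lemma expected_regret_eq: "expected_regret \<rho> \<mu> \<nu> pol n = (\<integral>w. (\<Sum>t<n. \<mu> Type1 - \<mu> (kind w t)) \<partial>P)"
proof -
  note [simp] = expectation_reward
  have AE: "AE w in P. regret \<rho> \<mu> pol w n = (\<Sum>t<n. \<mu> Type1 - w (draw w t))"
    using AE_regular by eventually_elim (rule regret_eq)
  have "expected_regret \<rho> \<mu> \<nu> pol n = (\<integral>w. (\<Sum>t<n. \<mu> Type1 - w (draw w t)) \<partial>P)"
    unfolding expected_regret_def by (rule integral_cong_AE[OF _ _ AE]) measurable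
  also have "\<dots> = (\<Sum>t<n. (\<integral>w. \<mu> Type1 - w (draw w t) \<partial>P))"
    by (rule Bochner_Integration.integral_sum) simp
  also have "\<dots> = (\<Sum>t<n. (\<integral>w. \<mu> Type1 - \<mu> (kind w t) \<partial>P))"
    by (simp add: prob_space)
  also have "\<dots> = (\<integral>w. (\<Sum>t<n. \<mu> Type1 - \<mu> (kind w t)) \<partial>P)"
    by (rule Bochner_Integration.integral_sum[symmetric]) simp
  finally show ?thesis .
qed

subsection \<open>Outcomes without optimal arms\<close>

text \<open>Types are judged with the query count at the moment of the query, so passing from
  \<open>t\<close> to \<open>Suc t\<close> adds a single condition, on the coordinate
  \<open>Type_Draw (Suc t)\<close>.\<close>

definition all_inferior :: "(source \<Rightarrow> real) \<Rightarrow> nat \<Rightarrow> bool" where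
  "all_inferior w t \<longleftrightarrow>
     (\<forall>s<t. action w s = Suc s \<longrightarrow> \<rho> (Suc s) (queries w s) \<le> w (Type_Draw (Suc s)))"

lemma measurable_reservoir [measurable]: "(\<lambda>w. \<rho> s (queries w t)) \<in> borel_measurable P"
  by (rule measurable_compose[OF measurable_queries]) simp

lemma measurable_all_inferior [measurable]: "Measurable.pred P (\<lambda>w. all_inferior w t)"
  unfolding all_inferior_def by measurable

text \<open>By \<open>regular_action\<close> any arm in play was queried in the round bearing its
  name, where the event forces its type.\<close>

lemma kind_all_inferior:
  assumes "regular w" "all_inferior w n" "t < n"
  shows "kind w t = Type2"
proof -
  obtain a where a: "action w t = Suc a" "a \<le> t" "action w a = Suc a"
    using regular_action[OF assms(1), of t] by (cases "action w t") auto
  then have "\<rho> (Suc a) (queries w a) \<le> w (Type_Draw (Suc a))"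
    using assms(2,3) unfolding all_inferior_def by simp
  then show ?thesis
    using a by (simp add: kind_def type_of_arm_def num_queries_run[of a t])
qed

lemma all_inferior_update_type:
  assumes "regular w"
  shows "all_inferior (w(Type_Draw (Suc t) := x)) t = all_inferior w t"
  unfolding all_inferior_def
proof (intro all_cong imp_cong)
  fix s
  assume "s < t"
  then have "s < Suc t" by simp
  note past = action_update_type[OF assms this, of x] run_update_type[OF assms this, of x]
  show "action (w(Type_Draw (Suc t) := x)) s = Suc s \<longleftrightarrow> action w s = Suc s"
    by (simp only: past)
  show "\<rho> (Suc s) (queries (w(Type_Draw (Suc t) := x)) s) \<le> (w(Type_Draw (Suc t) := x)) (Type_Draw (Suc s))
      \<longleftrightarrow> \<rho> (Suc s) (queries w s) \<le> w (Type_Draw (Suc s))"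
    unfolding past using \<open>s < t\<close> by simp
qed

lemma integrable_all_inferior: "integrable P (indicat_real {w \<in> space P. all_inferior w n})"
  by (rule integrable_const_bound[of _ 1]) auto

text \<open>On the event each of the \<open>n\<close> rounds costs the gap; elsewhere the cost is at
  least 0 because type 1 has the larger mean.\<close>

lemma expected_regret_ge:
  assumes "\<mu> Type2 < \<mu> Type1"
  shows "prob {w \<in> space P. all_inferior w n} * (\<mu> Type1 - \<mu> Type2) * real n \<le> expected_regret \<rho> \<mu> \<nu> pol n"
proof -
  let ?A = "{w \<in> space P. all_inferior w n}" and ?c = "(\<mu> Type1 - \<mu> Type2) * real n"
  have le: "\<mu> k \<le> \<mu> Type1" for k using assms by (cases k) auto
  have "prob ?A * (\<mu> Type1 - \<mu> Type2) * real n = (\<integral>w. ?c * indicator ?A w \<partial>P)"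
    by simp
  also have "\<dots> \<le> (\<integral>w. (\<Sum>t<n. \<mu> Type1 - \<mu> (kind w t)) \<partial>P)"
  proof (rule integral_mono_AE)
    show "AE w in P. ?c * indicator ?A w \<le> (\<Sum>t<n. \<mu> Type1 - \<mu> (kind w t))"
      using AE_regular
    proof eventually_elim
      case (elim w)
      show ?case
      proof (cases "w \<in> ?A")
        case True
        then have "kind w t = Type2" if "t < n" for t
          using kind_all_inferior[OF elim _ that] by simp
        then show ?thesis using True by simp
      qed (simp add: le sum_nonneg)
    qed
  qed (auto intro!: expectation_reward(3) integrable_all_inferior)
  finally show ?thesis unfolding expected_regret_eq .
qed

text \<open>\<open>no_query\<close> and \<open>query\<close> are the submartingale inequality in the
  two cases of a round: a replay keeps the count \<open>j\<close>, a query raises it and keeps all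
  arms inferior with probability 1 - \<rho>. Leaving \<open>W\<close> abstract serves both reservoir
  models.\<close>

lemma weight_le_prob_all_inferior:
  fixes W :: "nat \<Rightarrow> nat \<Rightarrow> real"
  assumes \<rho>: "\<And>t j. 0 \<le> \<rho> (Suc t) j" "\<And>t j. \<rho> (Suc t) j \<le> 1"
    and W: "\<And>t j. 0 \<le> W t j" "\<And>t j. W t j \<le> 1"
    and no_query: "\<And>t j. W t j \<le> W (Suc t) j"
    and query: "\<And>t j. W t j \<le> (1 - \<rho> (Suc t) j) * W (Suc t) (Suc j)"
  shows "W 0 0 \<le> prob {w \<in> space P. all_inferior w n}"
proof -
  define M where "M w t = of_bool (all_inferior w t) * W t (queries w t)" for w t
  have [measurable]: "(\<lambda>w. W t (queries w t)) \<in> borel_measurable P" for t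
    by (rule measurable_compose[OF measurable_queries]) simp
  have M_int: "integrable P (\<lambda>w. M w t)" for t
    by (rule integrable_const_bound[of _ 1]) (auto simp: M_def W)
  have step: "(\<integral>w. M w t \<partial>P) \<le> (\<integral>w. M w (Suc t) \<partial>P)" for t
  proof -
    let ?s = "Type_Draw (Suc t)"
    \<comment> \<open>Averaging over a fresh type draw for arm \<open>Suc t\<close> plays the part
      of conditioning on the past and on the action of round \<open>Suc t\<close>.\<close>
    have "M w t \<le> (\<integral>x. M (w(?s := x)) (Suc t) \<partial>unit_uniform)" if reg: "regular w" for w
    proof (cases "action w t = Suc t")
      case False
      then have "M (w(?s := x)) (Suc t) = of_bool (all_inferior w t) * W (Suc t) (queries w t)" for x
        using all_inferior_update_type[OF reg, of t x] run_update_type[OF reg, of t "Suc t" x]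
          action_update_type[OF reg, of t "Suc t" x]
        by (auto simp: M_def all_inferior_def less_Suc_eq queries_Suc)
      then show ?thesis
        using no_query prob_space.prob_space[OF prob_space_unit_uniform] by (simp add: M_def)
    next
      case True
      \<comment> \<open>After a query the event survives exactly when the fresh uniform value is at
        least \<open>r\<close>, which has probability \<open>1 - r\<close>.\<close>
      define r where "r = \<rho> (Suc t) (queries w t)"
      have "M (w(?s := x)) (Suc t) =
          of_bool (all_inferior w t) * W (Suc t) (Suc (queries w t)) * indicator {r..} x" for x
        using all_inferior_update_type[OF reg, of t x] run_update_type[OF reg, of t "Suc t" x]
          action_update_type[OF reg, of t "Suc t" x] True
        by (auto simp: M_def all_inferior_def less_Suc_eq queries_Suc r_def)
      moreover have "measure unit_uniform {r..} = 1 - r"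
        unfolding r_def by (intro measure_unit_uniform_atLeast \<rho>)
      ultimately have "(\<integral>x. M (w(?s := x)) (Suc t) \<partial>unit_uniform) =
          of_bool (all_inferior w t) * W (Suc t) (Suc (queries w t)) * (1 - r)"
        by (simp add: unit_uniform_def)
      then show ?thesis
        using query[of t "queries w t"] by (simp add: M_def r_def mult.commute)
    qed
    then have "(\<integral>w. M w t \<partial>P) \<le> (\<integral>w. (\<integral>x. M (w(?s := x)) (Suc t) \<partial>unit_uniform) \<partial>P)"
      using AE_regular integral_resample(2)[OF M_int[of "Suc t"], of ?s]
      by (intro integral_mono_AE M_int) (auto elim!: eventually_mono)
    also have "\<dots> = (\<integral>w. M w (Suc t) \<partial>P)"
      using integral_resample(1)[OF M_int[of "Suc t"], of ?s] by simp
    finally show ?thesis .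
  qed
  \<comment> \<open>Before round 1 the event is vacuous and no query has been made, so
    \<open>M w 0\<close> is the constant \<open>W 0 0\<close>.\<close>
  have "W 0 0 = (\<integral>w. M w 0 \<partial>P)"
    by (simp add: M_def all_inferior_def num_queries_def prob_space)
  also have "\<dots> \<le> (\<integral>w. M w n \<partial>P)"
    by (rule lift_Suc_mono_le[where f="\<lambda>t. \<integral>w. M w t \<partial>P", OF step]) simp
  also have "\<dots> \<le> (\<integral>w. indicator {w \<in> space P. all_inferior w n} w \<partial>P)"
    by (intro integral_mono M_int integrable_all_inferior) (auto simp: M_def W)
  also have "\<dots> = prob {w \<in> space P. all_inferior w n}" by simp
  finally show ?thesis .
qed

end

section \<open>Weights for the two reservoirs and the resulting linear regret\<close>

lemma linear_regretI:
  fixes W :: "nat \<Rightarrow> nat \<Rightarrow> real"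
  assumes "\<And>t j. 0 \<le> \<rho> (Suc t) j" "\<And>t j. \<rho> (Suc t) j \<le> 1"
    and "\<And>t j. 0 \<le> W t j" "\<And>t j. W t j \<le> 1"
    and "\<And>t j. W t j \<le> W (Suc t) j"
    and "\<And>t j. W t j \<le> (1 - \<rho> (Suc t) j) * W (Suc t) (Suc j)"
    and "0 < W 0 0"
  shows "linear_regret \<rho>"
  unfolding linear_regret_def
\<comment> \<open>\<open>W\<close> is fixed before the means, reward laws, policy and horizon, so
  this constant is uniform in them.\<close>
proof (intro exI[of _ "W 0 0"] conjI allI impI)
  fix \<mu> \<nu> pol n
  assume gap: "\<mu> Type2 < \<mu> Type1" and "valid_reward_laws \<mu> \<nu>" "non_anticipating pol"
  then interpret bandit \<rho> \<mu> \<nu> pol by unfold_locales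
  have "W 0 0 \<le> prob {w \<in> space P. all_inferior w n}"
    by (rule weight_le_prob_all_inferior) fact+
  then have "W 0 0 * (\<mu> Type1 - \<mu> Type2) * real n
      \<le> prob {w \<in> space P. all_inferior w n} * (\<mu> Type1 - \<mu> Type2) * real n"
    using gap by (intro mult_right_mono) auto
  also have "\<dots> \<le> expected_regret \<rho> \<mu> \<nu> pol n"
    by (rule expected_regret_ge[OF gap])
  finally show "W 0 0 * (\<mu> Type1 - \<mu> Type2) * real n \<le> expected_regret \<rho> \<mu> \<nu> pol n" .
qed fact

text \<open>\<open>w k\<close> is the infinite product of \<open>1 - b i\<close> over
  \<open>i \<ge> k\<close>. Summability makes it converge to a nonzero limit, positive since every
  factor is; splitting off the first factor gives the recursion.\<close>

lemma tail_products:
  fixes b :: "nat \<Rightarrow> real"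
  assumes "summable b" and b: "\<And>k. 0 \<le> b k" "\<And>k. b k < 1"
  obtains w :: "nat \<Rightarrow> real" where "\<And>k. 0 < w k" "\<And>k. w k \<le> 1" "\<And>k. w k = (1 - b k) * w (Suc k)"
proof -
  let ?f = "\<lambda>k. 1 - b k"
  have "abs_convergent_prod ?f"
    using assms by (intro summable_imp_abs_convergent_prod) simp
  then have conv: "convergent_prod ?f" by (rule abs_convergent_prod_imp_convergent_prod)
  define w where "w k = (\<Prod>i. ?f (i + k))" for k
  have conv_k: "convergent_prod (\<lambda>i. ?f (i + k))" for k
    by (rule convergent_prod_ignore_initial_segment[OF conv])
  have "0 < w k" for k unfolding w_def
    by (rule has_prod_pos[OF convergent_prod_has_prod[OF conv_k]]) (simp add: b)
  moreover have "w k \<le> 1" for k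
    unfolding w_def by (rule prodinf_le_const[OF conv_k]) (simp add: b less_imp_le prod_le_1)
  moreover have "w k = (1 - b k) * w (Suc k)" for k
    using prodinf_split_head[OF conv_k[of k]] b(2)[of k] by (simp add: w_def mult.commute)
  ultimately show thesis using that by blast
qed

lemma linear_regret_exogenous:
  assumes "model1 \<alpha>" "summable (\<lambda>t. \<alpha> (Suc t))"
  shows "linear_regret (exogenous \<alpha>)"
proof -
  have \<alpha>: "0 \<le> \<alpha> (Suc t)" "\<alpha> (Suc t) < 1" for t
    using assms(1) unfolding model1_def by (auto intro: order.strict_trans1[of _ "\<alpha> 1"])
  then obtain w where w: "\<And>k. 0 < w k" "\<And>k. w k \<le> 1" "\<And>k. w k = (1 - \<alpha> (Suc k)) * w (Suc k)"
    using tail_products[of "\<lambda>t. \<alpha> (Suc t)"] assms(2) by blast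
  \<comment> \<open>A round without a query drops a factor at most 1 from the tail product; this is
    the replay case for a weight depending on the round alone.\<close>
  have "w k \<le> w (Suc k)" for k
    unfolding w(3)[of k] using \<alpha>[of k] w(1)[of "Suc k"] by (simp add: mult_left_le_one_le)
  then show ?thesis
    by (intro linear_regretI[where W="\<lambda>t j. w t"])
      (simp_all add: exogenous_def \<alpha> w(1,2) w(3)[symmetric] less_imp_le)
qed

lemma linear_regret_endogenous:
  assumes "model2 g" "summable (\<lambda>t. g (Suc t))"
  shows "linear_regret (endogenous g)"
proof -
  have g: "0 \<le> g j" "g j < 1" for j
    using assms(1) unfolding model2_def by (auto intro: less_imp_le order.strict_trans1[of _ "g 0"] dest: antimonoD[of g 0 j])
  \<comment> \<open>The first query succeeds with probability \<open>g 0\<close>, so the product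
    starts at index 0, while the given series starts at 1.\<close>
  have "summable g" using assms(2) by (simp add: summable_Suc_iff)
  then obtain w where w: "\<And>k. 0 < w k" "\<And>k. w k \<le> 1" "\<And>k. w k = (1 - g k) * w (Suc k)"
    using tail_products[of g] g by blast
  show ?thesis
    \<comment> \<open>The weight depends on the query count alone, so a replay leaves it
      unchanged.\<close>
    by (intro linear_regretI[where W="\<lambda>t j. w j"])
      (simp_all add: endogenous_def g w(1,2) w(3)[symmetric] less_imp_le)
qed

lemma linear_regret_not_sublinear:
  assumes "linear_regret \<rho>"
  shows "\<not> sublinear_regret_achievable \<rho>"
proof
  assume "sublinear_regret_achievable \<rho>"
  then obtain \<mu> \<nu> pol where gap: "\<mu> Type2 < \<mu> Type1" and "valid_reward_laws \<mu> \<nu>" "non_anticipating pol"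
    and o: "expected_regret \<rho> \<mu> \<nu> pol \<in> o(real)"
    unfolding sublinear_regret_achievable_def by blast
  with assms obtain C where C: "C > 0"
    and ge: "\<And>n. C * (\<mu> Type1 - \<mu> Type2) * real n \<le> expected_regret \<rho> \<mu> \<nu> pol n"
    unfolding linear_regret_def by blast
  define c where "c = C * (\<mu> Type1 - \<mu> Type2)"
  have c: "0 < c" using C gap by (simp add: c_def)
  \<comment> \<open>Half the linear rate \<open>c\<close> suffices for a contradiction with the
    lower bound.\<close>
  have "eventually (\<lambda>n. norm (expected_regret \<rho> \<mu> \<nu> pol n) \<le> c / 2 * norm (real n)) at_top"
    by (rule landau_o.smallD[OF o]) (use c in simp)
  then obtain N where N: "\<And>n. n \<ge> N \<Longrightarrow> norm (expected_regret \<rho> \<mu> \<nu> pol n) \<le> c / 2 * norm (real n)"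
    unfolding eventually_at_top_linorder by blast
  \<comment> \<open>Horizon \<open>Suc N\<close> is positive even if \<open>N\<close> is 0, so it
    can be cancelled.\<close>
  have "c * real (Suc N) \<le> norm (expected_regret \<rho> \<mu> \<nu> pol (Suc N))"
    by (rule order_trans[OF ge[folded c_def]]) simp
  also have "\<dots> \<le> c / 2 * norm (real (Suc N))"
    by (rule N) simp
  finally have "c * real (Suc N) \<le> c / 2 * real (Suc N)"
    by (simp only: real_norm_def abs_of_nat)
  then have "c \<le> c / 2"
    by (rule mult_right_le_imp_le) simp
  with c show False by simp
qed

theorem theorem1:
  shows "(\<forall>\<alpha>. model1 \<alpha> \<longrightarrow>
           (summable (\<lambda>t. \<alpha> (Suc t)) \<longrightarrow> linear_regret (exogenous \<alpha>)) \<and>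
           (sublinear_regret_achievable (exogenous \<alpha>) \<longrightarrow> \<not> summable (\<lambda>t. \<alpha> (Suc t)))) \<and>
         (\<forall>g. model2 g \<longrightarrow>
           (summable (\<lambda>t. g (Suc t)) \<longrightarrow> linear_regret (endogenous g)) \<and>
           (sublinear_regret_achievable (endogenous g) \<longrightarrow> \<not> summable (\<lambda>t. g (Suc t))))"
  using linear_regret_exogenous linear_regret_endogenous linear_regret_not_sublinear by blast

end
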